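(* Let $q$ be a prime of the form $3k+1$ and write $4q=L^2+27M^2$ with $L,M\in\mathbb{Z}$ and $L\equiv 1\pmod 3$. Let $p$ be a prime with $p\neq 2,3,q$ and $p\nmid L(L^2-9M^2)$. Then the congruence $x^3-qx-qM\equiv 0\pmod p$ has three solutions if and only if $p$ is a cubic residue of $q$.
   Context: The number of solutions of a congruence modulo $p$ is the number of residue classes $x$ modulo $p$ satisfying it. "$p$ is a cubic residue of $q$" means that $p\equiv y^3\pmod q$ for some integer $y$. *)

theory Defs
  imports "HOL-Number_Theory.Number_Theory"
begin

text \<open>Residue classes modulo \<open>m > 0\<close> are represented by the integers \<open>0, \<dots>, m - 1\<close>;
  \<open>f\<close> is meant to be an integer polynomial function, so that the congruence
  \<open>f x \<equiv> 0\<close> depends only on the residue class of \<open>x\<close>.\<close>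

definition num_solutions_mod :: "(int \<Rightarrow> int) \<Rightarrow> int \<Rightarrow> nat" where
  "num_solutions_mod f m = card {x \<in> {0..<m}. [f x = 0] (mod m)}"

definition cubic_residue_of :: "int \<Rightarrow> int \<Rightarrow> bool" where
  "cubic_residue_of p q \<longleftrightarrow> (\<exists>y::int. [p = y ^ 3] (mod q))"

end

theory Submission
  imports Defs "HOL-Computational_Algebra.Polynomial"
begin

text \<open>
  Let \<open>\<eta>\<^sub>0, \<eta>\<^sub>1, \<eta>\<^sub>2\<close> be the cubic Gauss periods for \<open>q\<close>. Their differences
  \<open>\<eta>\<^sub>i - \<eta>\<^sub>i\<^sub>+\<^sub>1\<close> are the roots of \<open>x\<^sup>3 - q x - q b\<close> for an integer \<open>b\<close>, and the discriminant
  of this cubic is \<open>(q a)\<^sup>2\<close> for an integer \<open>a\<close>; hence \<open>4 q = a\<^sup>2 + 27 b\<^sup>2\<close>, which forces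
  \<open>b = \<plusminus>M\<close>. Modulo \<open>p\<close> the Frobenius map permutes the \<open>\<eta>\<^sub>i\<close> cyclically by the cubic class of
  \<open>p\<close> modulo \<open>q\<close>, so the cubic has a root modulo \<open>p\<close> iff \<open>p\<close> is a cubic residue of \<open>q\<close>. As the
  discriminant is a nonzero square modulo \<open>p\<close>, one root entails three.

  The ring \<open>\<int>[\<zeta>]\<close> of \<open>q\<close>-th roots of unity and its reduction modulo \<open>p\<close> are represented by
  \<open>\<int>[x]\<close> with congruence modulo the ideals \<open>(0, \<Phi>)\<close> and \<open>(p, \<Phi>)\<close>, where
  \<open>\<Phi> = 1 + x + \<dots> + x\<^bsup>q-1\<^esup>\<close>. Neither the irreducibility of \<open>\<Phi>\<close> nor the primality of an ideal
  above \<open>p\<close> is needed.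
\<close>

section \<open>Congruence modulo an ideal with two generators\<close>

text \<open>One relation serves every modulus below: \<open>(0, x^q - 1)\<close> for comparing
  coefficients, \<open>(0, \<Phi>)\<close> for identities in characteristic 0, and
  \<open>(p, \<Phi>)\<close> for the reduction.\<close>

definition ideal_cong :: "'a::comm_ring_1 \<Rightarrow> 'a \<Rightarrow> 'a \<Rightarrow> 'a \<Rightarrow> bool"
  where "ideal_cong u v a b \<longleftrightarrow> (\<exists>c d. a - b = u * c + v * d)"

lemma ideal_cong_refl [simp, intro]: "ideal_cong u v a a"
  unfolding ideal_cong_def by (intro exI[of _ 0]) simp

lemma ideal_cong_sym: "ideal_cong u v a b \<Longrightarrow> ideal_cong u v b a"
proof -
  assume "ideal_cong u v a b"
  then obtain c d where "a - b = u * c + v * d" by (auto simp: ideal_cong_def)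
  then have "b - a = u * (- c) + v * (- d)" by (simp add: algebra_simps)
  then show ?thesis unfolding ideal_cong_def by blast
qed

lemma ideal_cong_add:
  assumes "ideal_cong u v a b" "ideal_cong u v a' b'"
  shows "ideal_cong u v (a + a') (b + b')"
proof -
  obtain c d c' d' where "a - b = u * c + v * d" "a' - b' = u * c' + v * d'"
    using assms by (auto simp: ideal_cong_def)
  then have "(a + a') - (b + b') = u * (c + c') + v * (d + d')" by (simp add: algebra_simps)
  then show ?thesis unfolding ideal_cong_def by blast
qed

lemma ideal_cong_minus: "ideal_cong u v a b \<Longrightarrow> ideal_cong u v (- a) (- b)"
  using ideal_cong_sym[of u v a b] by (simp add: ideal_cong_def)

lemma ideal_cong_diff:
  "ideal_cong u v a b \<Longrightarrow> ideal_cong u v a' b' \<Longrightarrow> ideal_cong u v (a - a') (b - b')"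
  using ideal_cong_add[OF _ ideal_cong_minus, of u v a b a' b'] by simp

lemma ideal_cong_trans [trans]:
  "ideal_cong u v a b \<Longrightarrow> ideal_cong u v b c \<Longrightarrow> ideal_cong u v a c"
  using ideal_cong_add[of u v a b b c] by (simp add: ideal_cong_def)

lemma ideal_cong_mult:
  assumes "ideal_cong u v a b" "ideal_cong u v a' b'"
  shows "ideal_cong u v (a * a') (b * b')"
proof -
  obtain c d c' d' where *: "a - b = u * c + v * d" "a' - b' = u * c' + v * d'"
    using assms by (auto simp: ideal_cong_def)
  have "a * a' - b * b' = (a - b) * a' + b * (a' - b')" by (simp add: algebra_simps)
  also have "\<dots> = u * (c * a' + b * c') + v * (d * a' + b * d')"
    unfolding * by (simp add: algebra_simps)
  finally show ?thesis unfolding ideal_cong_def by blast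
qed

lemma ideal_cong_power: "ideal_cong u v a b \<Longrightarrow> ideal_cong u v (a ^ n) (b ^ n)"
  by (induction n) (auto intro: ideal_cong_mult)

lemma ideal_cong_sum:
  "(\<And>i. i \<in> A \<Longrightarrow> ideal_cong u v (f i) (h i)) \<Longrightarrow> ideal_cong u v (sum f A) (sum h A)"
  by (induction A rule: infinite_finite_induct) (auto intro: ideal_cong_add)

lemma ideal_cong_prod:
  "(\<And>i. i \<in> A \<Longrightarrow> ideal_cong u v (f i) (h i)) \<Longrightarrow> ideal_cong u v (prod f A) (prod h A)"
  by (induction A rule: infinite_finite_induct) (auto intro: ideal_cong_mult)

text \<open>Carries congruences modulo \<open>x^q - 1\<close> to \<open>\<Phi>\<close>, and those
  modulo either to \<open>(p, \<Phi>)\<close>.\<close>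

lemma ideal_cong_mono:
  assumes "ideal_cong 0 w a b" "v dvd w"
  shows "ideal_cong u v a b"
proof -
  obtain d where "a - b = w * d" using assms(1) by (auto simp: ideal_cong_def)
  moreover obtain e where "w = v * e" using assms(2) by blast
  ultimately have "a - b = u * 0 + v * (e * d)" by (simp add: mult.assoc)
  then show ?thesis unfolding ideal_cong_def by blast
qed

lemma ideal_cong_dvd_left: "u dvd a - b \<Longrightarrow> ideal_cong u v a b"
  unfolding ideal_cong_def by (metis add.right_neutral dvdE mult_zero_right)

lemma ideal_cong_0_iff: "ideal_cong 0 v a b \<longleftrightarrow> v dvd a - b"
  by (auto simp: ideal_cong_def)

lemma monic_division:
  fixes f g :: "'a::comm_ring_1 poly"
  assumes "lead_coeff g = 1" "degree g > 0"
  shows "\<exists>s r. f = g * s + r \<and> degree r < degree g"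
proof -
  obtain s r where sr: "pseudo_divmod f g = (s, r)" by force
  have "g \<noteq> 0" using assms(2) by auto
  from pseudo_divmod[OF this sr] assms have "f = g * s + r" "r = 0 \<or> degree r < degree g"
    by simp_all
  then show ?thesis using assms(2) by (metis degree_0)
qed

text \<open>Returns from the quotient ring to the integers. After the cofactor of \<open>u\<close>
  is reduced by the monic \<open>F\<close>, degrees force the multiple of \<open>F\<close> to
  vanish, and the constant coefficients remain. For \<open>u = 0\<close> the conclusion is
  equality.\<close>

lemma ideal_cong_const_dvd:
  fixes F :: "int poly"
  assumes "ideal_cong (of_int u) F (of_int a) (of_int b)" "lead_coeff F = 1" "degree F > 0"
  shows "u dvd a - b"
proof -
  obtain C D where CD: "of_int a - of_int b = of_int u * C + F * D"
    using assms(1) by (auto simp: ideal_cong_def)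
  obtain s r where sr: "C = F * s + r" "degree r < degree F"
    using monic_division assms(2,3) by blast
  have eq: "of_int (a - b) - of_int u * r = F * (D + of_int u * s)"
    using CD unfolding sr(1) by (simp add: algebra_simps)
  have "degree (of_int (a - b) - of_int u * r) < degree F"
    using sr(2) assms(3) by (intro degree_diff_less) (auto simp: of_int_poly)
  then have "F * (D + of_int u * s) = 0"
    using eq degree_mult_eq[of F "D + of_int u * s"] assms(3) 
    by (metis leD le_add1 mult_eq_0_iff)
  then have "of_int (a - b) = of_int u * r" using eq by (metis eq_iff_diff_eq_0)
  then have "coeff (of_int (a - b)) 0 = coeff (of_int u * r) 0" by simp
  then have "a - b = u * coeff r 0" by (simp add: of_int_poly)
  then show ?thesis by simp
qed

lemma pcompose_monom: 
  fixes h :: "'a::comm_semiring_1 poly"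
  shows "pcompose (monom c n) h = smult c (h ^ n)"
  by (induction n) (simp_all add: monom_0 monom_Suc pcompose_pCons)

lemma pcompose_monom_monom:
  "pcompose (monom c n) (monom (1::'a::comm_semiring_1) m) = monom c (n * m)"
  by (simp add: pcompose_monom monom_power smult_monom mult.commute)

lemma pcompose_of_int [simp]:
  fixes h :: "'a::comm_ring_1 poly"
  shows "pcompose (of_int a) h = of_int a"
  by (simp add: of_int_poly)

section \<open>Frobenius and the polynomial \<open>x^p - x\<close> modulo \<open>p\<close>\<close>

lemma ideal_cong_freshmans_dream:
  fixes a b :: "'a::comm_ring_1"
  assumes "prime p"
  shows "ideal_cong (of_nat p) v ((a + b) ^ p) (a ^ p + b ^ p)"
proof (rule ideal_cong_dvd_left)
  have p0: "p > 0" using assms prime_gt_0_nat by blast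
  have "(a + b) ^ p = (\<Sum>k\<le>p. of_nat (p choose k) * a ^ k * b ^ (p - k))"
    by (rule binomial_ring)
  also have "{..p} = insert 0 (insert p {1..<p})" using p0 by auto
  also have "(\<Sum>k\<in>\<dots>. of_nat (p choose k) * a ^ k * b ^ (p - k)) =
      b ^ p + (a ^ p + (\<Sum>k\<in>{1..<p}. of_nat (p choose k) * a ^ k * b ^ (p - k)))"
    using p0 by simp
  finally have "(a + b) ^ p - (a ^ p + b ^ p) =
      (\<Sum>k\<in>{1..<p}. of_nat (p choose k) * a ^ k * b ^ (p - k))" by simp
  also have "of_nat p dvd \<dots>"
  proof (rule dvd_sum)
    fix k assume "k \<in> {1..<p}"
    then have "p dvd (p choose k)" using assms by (intro dvd_choose_prime) auto
    then have "(of_nat p :: 'a) dvd of_nat (p choose k)" by (metis dvdE dvd_triv_left of_nat_mult)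
    then show "(of_nat p :: 'a) dvd of_nat (p choose k) * a ^ k * b ^ (p - k)"
      by (simp add: mult.assoc)
  qed
  finally show "of_nat p dvd (a + b) ^ p - (a ^ p + b ^ p)" .
qed

lemma fermat_int:
  fixes a :: int
  assumes "prime p"
  shows "int p dvd a ^ p - a"
proof (cases "int p dvd a")
  case True
  moreover have "a dvd a ^ p" using prime_gt_0_nat[OF assms] by (intro dvd_power) auto
  ultimately have "int p dvd a ^ p" by (rule dvd_trans)
  then show ?thesis using True by (rule dvd_diff)
next
  case False
  define b where "b = nat (a mod int p)"
  have p0: "p > 0" using assms prime_gt_0_nat by blast
  have b: "int b = a mod int p" using p0 by (simp add: b_def)
  then have ab: "[a = int b] (mod int p)" by (simp add: cong_def)
  have "\<not> p dvd b" using False ab by (meson cong_dvd_iff of_nat_dvd_iff)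
  from fermat_theorem[OF assms this] have "[b ^ (p - 1) * b = 1 * b] (mod p)"
    by (intro cong_mult) auto
  then have "[b ^ p = b] (mod p)" using p0 by (simp flip: power_Suc2)
  then have "[int b ^ p = int b] (mod int p)" by (metis cong_int_iff of_nat_power)
  then have "[a ^ p = a] (mod int p)" 
    using cong_trans[OF cong_pow[OF ab] cong_trans[OF _ cong_sym[OF ab]]] by simp
  then show ?thesis by (simp add: cong_iff_dvd_diff)
qed

text \<open>Induction along \<open>a + x f\<close>: the binomial congruence splits the sum, and
  Fermat's theorem fixes the constant \<open>a\<close>. Taking \<open>p\<close>-th powers thus
  becomes the substitution of \<open>x^p\<close> for \<open>x\<close>.\<close>

lemma ideal_cong_frobenius:
  fixes f :: "int poly"
  assumes "prime p"
  shows "ideal_cong (of_nat p) v (f ^ p) (pcompose f (monom 1 p))"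
proof (induction f)
  case 0
  then show ?case using prime_gt_0_nat[OF assms] by (simp add: zero_power)
next
  case (pCons a f)
  have eq: "pCons a f = of_int a + monom 1 1 * f"
    by (simp add: of_int_poly monom_altdef)
  have "ideal_cong (of_nat p) v (pCons a f ^ p) (of_int a ^ p + (monom 1 1 * f) ^ p)"
    unfolding eq by (rule ideal_cong_freshmans_dream[OF assms])
  also have "ideal_cong (of_nat p) v \<dots> (of_int a + monom 1 p * pcompose f (monom 1 p))"
  proof (rule ideal_cong_add)
    obtain c where "a ^ p - a = int p * c" using fermat_int[OF assms] by (meson dvdE)
    then have "(of_int (a ^ p - a) :: int poly) = of_nat p * of_int c"
      by (metis of_int_mult of_int_of_nat_eq)
    then show "ideal_cong (of_nat p) v (of_int a ^ p) (of_int a :: int poly)"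
      by (intro ideal_cong_dvd_left) simp
    show "ideal_cong (of_nat p) v ((monom 1 1 * f) ^ p) (monom 1 p * pcompose f (monom 1 p))"
      unfolding power_mult_distrib monom_power
      by (intro ideal_cong_mult pCons.IH) simp
  qed
  also have "of_int a + monom 1 p * pcompose f (monom 1 p) = pcompose (pCons a f) (monom 1 p)"
    by (simp add: pcompose_pCons of_int_poly)
  finally show ?case .
qed

text \<open>A nonzero polynomial over the field of \<open>p\<close> elements has at most as many
  roots as its degree. The linear factor at \<open>n\<close> is split off; the earlier roots pass to
  the quotient because \<open>n - i\<close> lies strictly between 0 and \<open>p\<close>.\<close>

lemma dvd_poly_if_many_roots:
  fixes f :: "int poly"
  assumes "prime p" "n \<le> p" "degree f < n" "\<And>i. i < n \<Longrightarrow> int p dvd poly f (int i)"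
  shows "[:int p:] dvd f"
  using assms(2-)
proof (induction n arbitrary: f)
  case (Suc n)
  define h where "h = synthetic_div f (int n)"
  have f: "[:- int n, 1:] * h + [:poly f (int n):] = f"
    unfolding h_def by (rule synthetic_div_correct')
  have "[:int p:] dvd h"
  proof (cases "h = 0")
    case False
    then have "degree f = Suc (degree h)"
      using synthetic_div_eq_0_iff[of f "int n"] degree_synthetic_div[of f "int n"]
      by (simp add: h_def)
    with Suc.prems(1,2) have "n \<le> p" "degree h < n" by auto
    then show ?thesis
    proof (rule Suc.IH)
      fix i assume i: "i < n"
      have "poly f (int i) = (int i - int n) * poly h (int i) + poly f (int n)"
        by (subst f[symmetric]) (simp add: algebra_simps)
      then have "int p dvd (int i - int n) * poly h (int i)"
        using Suc.prems(3)[of i] Suc.prems(3)[of n] i dvd_add_left_iff by (metis less_Suc_eq)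
      moreover have "\<not> int p dvd int n - int i"
        using i Suc.prems(1) by (intro zdvd_not_zless) auto
      then have "\<not> int p dvd int i - int n" by (subst dvd_diff_commute)
      ultimately show "int p dvd poly h (int i)"
        using assms(1) prime_dvd_multD[of "int p"] by (metis prime_int_nat_transfer prime_nat_int_transfer)
    qed
  qed auto
  moreover have "[:int p:] dvd [:poly f (int n):]"
    using Suc.prems(3)[of n] by (simp add: const_poly_dvd_iff coeff_pCons split: nat.split)
  ultimately have "[:int p:] dvd [:- int n, 1:] * h + [:poly f (int n):]"
    by (intro dvd_add dvd_mult)
  then show ?case unfolding f .
qed auto

text \<open>\<open>x^p - x\<close> and the product of all \<open>x - j\<close> are monic of degree
  \<open>p\<close> and agree modulo \<open>p\<close> at the \<open>p\<close> residues, so their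
  difference vanishes modulo \<open>p\<close>. Substituting \<open>f\<close> gives the
  claim.\<close>

lemma dvd_power_minus_self_minus_prod:
  fixes f :: "int poly"
  assumes "prime p"
  shows "of_nat p dvd f ^ p - f - (\<Prod>j<p. f - of_nat j)"
proof -
  define G :: "int poly" where "G = (\<Prod>j<p. [:- int j, 1:])"
  have p2: "p \<ge> 2" using assms prime_ge_2_nat by blast
  have root_shift: "pcompose [:- int j, 1:] f = f - of_nat j" for j
    by (simp add: pcompose_pCons of_nat_poly)
  have degG: "degree G = p"
  proof -
    have "degree G = (\<Sum>j<p. degree [:- int j, 1:])"
      unfolding G_def by (rule degree_prod_sum_eq) simp
    then show ?thesis by simp
  qed
  have lG: "lead_coeff G = 1" 
    unfolding G_def lead_coeff_prod by simp
  \<comment> \<open>The leading terms cancel; \<open>p \<ge> 2\<close> keeps the term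
    \<open>x\<close> out of degree \<open>p\<close>.\<close>
  have deg: "degree (monom 1 p - monom 1 1 - G) < p"
  proof (rule degree_lessI)
    show "monom 1 p - monom 1 1 - G \<noteq> 0 \<or> p > 0" using p2 by (intro disjI2) linarith
    have "coeff G i = (if i = p then 1 else 0)" if "i \<ge> p" for i
      using that lG degG coeff_eq_0[of G i] by auto
    then show "\<forall>i\<ge>p. coeff (monom 1 p - monom 1 1 - G) i = 0"
      using p2 by simp
  qed
  have "[:int p:] dvd monom 1 p - monom 1 1 - G"
  proof (rule dvd_poly_if_many_roots[OF assms order_refl deg])
    fix i assume "i < p"
    then have "poly G (int i) = 0" unfolding G_def poly_prod by (intro prod_zero) auto
    then show "int p dvd poly (monom 1 p - monom 1 1 - G) (int i)"
      using fermat_int[OF assms, of "int i"] by (simp add: poly_monom)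
  qed
  then obtain h where "monom 1 p - monom 1 1 - G = [:int p:] * h" by (rule dvdE)
  from arg_cong[OF this, of "\<lambda>r. pcompose r f"]
  have "f ^ p - f - pcompose G f = of_nat p * pcompose h f"
    by (simp add: pcompose_diff pcompose_mult pcompose_monom pcompose_smult of_nat_poly)
  moreover have "pcompose G f = (\<Prod>j<p. f - of_nat j)"
    unfolding G_def pcompose_prod
    by (intro prod.cong refl) (unfold root_shift, rule refl)
  ultimately show ?thesis by simp
qed

section \<open>Cyclotomic integers invariant under a primitive root\<close>

definition all_one_poly :: "nat \<Rightarrow> int poly"
  where "all_one_poly n = (\<Sum>i<n. monom 1 i)"

lemma coeff_all_one_poly: "coeff (all_one_poly n) i = (if i < n then 1 else 0)"
  by (simp add: all_one_poly_def coeff_sum)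

lemma degree_all_one_poly: "degree (all_one_poly n) = n - 1"
proof (cases n)
  case (Suc m)
  show ?thesis
  proof (rule antisym)
    show "degree (all_one_poly n) \<le> n - 1"
      by (rule degree_le) (auto simp: coeff_all_one_poly)
    show "n - 1 \<le> degree (all_one_poly n)"
      by (rule le_degree) (simp add: coeff_all_one_poly Suc)
  qed
qed (simp add: all_one_poly_def)

lemma lead_coeff_all_one_poly: "n > 0 \<Longrightarrow> lead_coeff (all_one_poly n) = 1"
  by (simp add: degree_all_one_poly coeff_all_one_poly)

lemma all_one_poly_dvd: "all_one_poly n dvd monom 1 n - 1"
  using power_diff_1_eq[of "monom (1::int) 1" n] by (simp add: monom_power all_one_poly_def)

lemma degree_monom_minus_1: "degree (monom (1::int) n - 1) = n"
proof (cases "n = 0")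
  case False
  then show ?thesis
    by (intro antisym degree_le le_degree) (auto simp: coeff_1)
qed (simp add: monom_0 one_pCons)

lemma ideal_cong_monom:
  assumes "[a = b] (mod n)"
  shows "ideal_cong 0 (monom 1 n - 1) (monom c a) (monom (c::int) b)"
proof -
  have *: "ideal_cong 0 (monom 1 n - 1) (monom c a) (monom c (a mod n))" for a
  proof -
    have "ideal_cong 0 (monom 1 n - 1) (monom (1::int) n) 1"
      by (simp add: ideal_cong_0_iff)
    then have "ideal_cong 0 (monom 1 n - 1) (monom (1::int) n ^ (a div n) * monom c (a mod n))
        (1 ^ (a div n) * monom c (a mod n))"
      by (intro ideal_cong_mult ideal_cong_power) auto
    then show ?thesis by (simp add: monom_power mult_monom)
  qed
  show ?thesis
    using ideal_cong_trans[OF *[of a] ideal_cong_sym] *[of b] assms by (simp add: cong_def)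
qed

text \<open>A nonzero multiple of \<open>x^n - 1\<close> has degree at least \<open>n\<close>.
  Representatives of degree below \<open>n\<close> are therefore unique, which makes their
  coefficients meaningful.\<close>

lemma ideal_cong_reduced_eq:
  assumes "ideal_cong 0 (monom 1 n - 1) f h" "degree f < n" "degree h < n"
  shows "f = (h :: int poly)"
proof (rule ccontr)
  assume "f \<noteq> h"
  then have "n \<le> degree (f - h)"
    using assms(1) dvd_imp_degree_le[of "monom 1 n - 1" "f - h"]
    by (simp add: ideal_cong_0_iff degree_monom_minus_1)
  moreover have "degree (f - h) < n" using assms by (intro degree_diff_less)
  ultimately show False by simp
qed

lemma ex_reduced:
  assumes "n > 0"
  shows "\<exists>h. degree h < n \<and> ideal_cong 0 (monom (1::int) n - 1) f h"
proof -
  have "lead_coeff (monom (1::int) n - 1) = 1"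
    using assms by (simp add: degree_monom_minus_1 coeff_1)
  then obtain s r where "f = (monom 1 n - 1) * s + r" "degree r < n"
    using monic_division[of "monom (1::int) n - 1" f] assms by (auto simp: degree_monom_minus_1)
  then show ?thesis by (intro exI[of _ r]) (simp add: ideal_cong_0_iff)
qed

text \<open>The map sending \<open>x\<close> to \<open>x^g\<close> is well defined on the quotient,
  as \<open>x^n - 1\<close> divides \<open>x^(n g) - 1\<close>.\<close>

lemma pcompose_monom_cong:
  assumes "ideal_cong 0 (monom 1 n - 1) f (h :: int poly)"
  shows "ideal_cong 0 (monom 1 n - 1) (pcompose f (monom 1 g)) (pcompose h (monom 1 g))"
proof -
  obtain s where "f - h = (monom 1 n - 1) * s" using assms by (auto simp: ideal_cong_def)
  from arg_cong[OF this, of "\<lambda>r. pcompose r (monom 1 g)"]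
  have "pcompose f (monom 1 g) - pcompose h (monom 1 g) = 
      (monom 1 (n * g) - 1) * pcompose s (monom 1 g)"
    by (simp add: pcompose_diff pcompose_mult pcompose_monom_monom pcompose_1)
  moreover have "monom (1::int) n - 1 dvd monom 1 (n * g) - 1"
    using power_diff_1_eq[of "monom (1::int) n" g] by (simp add: monom_power)
  ultimately show ?thesis by (simp add: ideal_cong_0_iff)
qed

locale primitive_root =
  fixes q g :: nat
  assumes prime_q: "prime q" and coprime_g: "coprime q g" and ord_g: "ord q g = q - 1"
begin

lemma q_gt_1: "q > 1"
  using prime_q prime_gt_1_nat by blast

lemma power_g_cong_iff: "[g ^ a = g ^ b] (mod q) \<longleftrightarrow> [a = b] (mod (q - 1))"
  using order_divides_expdiff[OF coprime_g] by (simp add: ord_g)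

text \<open>The \<open>q - 1\<close> powers of \<open>g\<close> are distinct modulo
  \<open>q\<close>, hence fill the nonzero residues.\<close>

lemma ex_power_g:
  assumes "\<not> q dvd a"
  shows "\<exists>n. [a = g ^ n] (mod q)"
proof -
  have sub: "(\<lambda>n. g ^ n mod q) ` {..<q - 1} \<subseteq> {1..<q}"
  proof
    fix x assume "x \<in> (\<lambda>n. g ^ n mod q) ` {..<q - 1}"
    then obtain n where x: "x = g ^ n mod q" by blast
    have "coprime q (g ^ n)" using coprime_g by simp
    then have "\<not> q dvd g ^ n" using q_gt_1 by (metis coprime_absorb_left nat_dvd_1_iff_1 less_irrefl)
    then show "x \<in> {1..<q}" using x q_gt_1 by (auto simp: mod_greater_zero_iff_not_dvd Suc_le_eq)
  qed
  have "inj_on (\<lambda>n. g ^ n mod q) {..<q - 1}"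
  proof (rule inj_onI)
    fix a b assume ab: "a \<in> {..<q - 1}" "b \<in> {..<q - 1}" "g ^ a mod q = g ^ b mod q"
    then have "[a = b] (mod (q - 1))" using power_g_cong_iff by (simp add: cong_def)
    with ab show "a = b" by (simp add: cong_def)
  qed
  then have "card ((\<lambda>n. g ^ n mod q) ` {..<q - 1}) = card {1..<q}"
    by (simp add: card_image)
  then have eq: "(\<lambda>n. g ^ n mod q) ` {..<q - 1} = {1..<q}"
    using sub card_subset_eq[of "{1..<q}"] by blast
  have "a mod q \<in> {1..<q}" using assms q_gt_1 by (auto simp: mod_greater_zero_iff_not_dvd Suc_le_eq)
  with eq obtain n where "a mod q = g ^ n mod q" by blast
  then show ?thesis by (auto simp: cong_def)
qed

text \<open>The substitution moves the coefficient at \<open>s\<close> to \<open>s g mod q\<close>,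
  without collisions. Invariance makes coefficients constant along orbits of multiplication by
  \<open>g\<close>, and the orbit of 1 is all nonzero exponents.\<close>

lemma coeff_invariant:
  assumes "degree h < q" "ideal_cong 0 (monom 1 q - 1) (pcompose h (monom 1 g)) (h :: int poly)"
    and "0 < t" "t < q"
  shows "coeff h t = coeff h 1"
proof -
  define h' where "h' = (\<Sum>s<q. monom (coeff h s) (s * g mod q))"
  have h: "h = (\<Sum>s<q. monom (coeff h s) s)"
    using poly_as_sum_of_monoms'[of h "q - 1"] assms(1) q_gt_1
    by (simp add: lessThan_Suc_atMost[symmetric] del: lessThan_Suc)
  have "pcompose h (monom 1 g) = (\<Sum>s<q. monom (coeff h s) (s * g))"
    by (subst h) (simp add: pcompose_sum pcompose_monom_monom)
  moreover have "ideal_cong 0 (monom 1 q - 1) (\<Sum>s<q. monom (coeff h s) (s * g)) h'"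
    unfolding h'_def by (intro ideal_cong_sum ideal_cong_monom) (simp add: cong_def)
  ultimately have "ideal_cong 0 (monom 1 q - 1) h h'"
    using assms(2) ideal_cong_sym ideal_cong_trans by metis
  moreover have "degree h' < q"
    unfolding h'_def using q_gt_1 
    by (intro degree_sum_less) (auto intro!: le_less_trans[OF degree_monom_le])
  ultimately have hh': "h = h'" using assms(1) by (intro ideal_cong_reduced_eq)
  have step: "coeff h (s * g mod q) = coeff h s" if "s < q" for s
  proof -
    have "s' * g mod q = s * g mod q \<longleftrightarrow> s' = s" if "s' < q" for s'
    proof -
      have "[s' * g = s * g] (mod q) \<longleftrightarrow> [s' = s] (mod q)"
        using coprime_g by (intro cong_mult_rcancel_nat) (simp add: coprime_commute)
      then show ?thesis using \<open>s < q\<close> \<open>s' < q\<close> by (simp add: cong_def)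
    qed
    then have "coeff h' (s * g mod q) = (\<Sum>s'<q. if s' = s then coeff h s' else 0)"
      unfolding h'_def coeff_sum by (intro sum.cong) auto
    then show ?thesis using that hh' by simp
  qed
  have "coeff h (g ^ n mod q) = coeff h 1" for n
  proof (induction n)
    case (Suc n)
    have "g ^ Suc n mod q = (g ^ n mod q) * g mod q" by (simp add: mod_simps mult.commute)
    then show ?case using step[of "g ^ n mod q"] Suc q_gt_1 by simp
  qed (use q_gt_1 in simp)
  moreover have "\<not> q dvd t" using assms by (auto dest: dvd_imp_le)
  then obtain n where "t mod q = g ^ n mod q" using ex_power_g by (auto simp: cong_def)
  ultimately show ?thesis using assms(4) by (metis mod_less)
qed

text \<open>With all coefficients beyond the constant one equal, \<open>h\<close> is an integer plus
  a multiple of \<open>\<Phi>\<close>. Evaluation at 1, a root of \<open>x^q - 1\<close>, relates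
  the two coefficients that remain.\<close>

lemma invariant_cong_int:
  fixes f h :: "int poly"
  assumes "ideal_cong 0 (monom 1 q - 1) (pcompose f (monom 1 g)) f"
    and "ideal_cong 0 (monom 1 q - 1) f h" "degree h < q"
  shows "ideal_cong 0 (all_one_poly q) f (of_int (coeff h 0 - coeff h 1))"
    and "poly f 1 = coeff h 0 + int (q - 1) * coeff h 1"
proof -
  have "ideal_cong 0 (monom 1 q - 1) (pcompose h (monom 1 g)) h"
    using pcompose_monom_cong[OF assms(2), of g] assms(1,2) 
    by (blast intro: ideal_cong_sym ideal_cong_trans)
  then have c: "coeff h t = coeff h 1" if "0 < t" "t < q" for t
    using coeff_invariant assms(3) that by blast
  have h: "h = of_int (coeff h 0 - coeff h 1) + of_int (coeff h 1) * all_one_poly q"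
  proof (rule poly_eqI)
    fix t
    show "coeff h t = coeff (of_int (coeff h 0 - coeff h 1) + of_int (coeff h 1) * all_one_poly q) t"
      using c[of t] assms(3) coeff_eq_0[of h t] q_gt_1
      by (cases "t = 0") (auto simp: of_int_poly coeff_all_one_poly coeff_pCons split: nat.split)
  qed
  have "ideal_cong 0 (all_one_poly q) f h"
    using assms(2) all_one_poly_dvd by (rule ideal_cong_mono)
  moreover have "ideal_cong 0 (all_one_poly q) h (of_int (coeff h 0 - coeff h 1))"
    by (subst h) (simp add: ideal_cong_0_iff)
  ultimately show "ideal_cong 0 (all_one_poly q) f (of_int (coeff h 0 - coeff h 1))"
    by (rule ideal_cong_trans)
  obtain s where "f - h = (monom 1 q - 1) * s" using assms(2) by (auto simp: ideal_cong_def)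
  from arg_cong[OF this, of "\<lambda>r. poly r 1"] have "poly f 1 = poly h 1" by (simp add: poly_monom)
  also have "\<dots> = coeff h 0 - coeff h 1 + coeff h 1 * int q"
    by (subst h) (simp add: all_one_poly_def poly_sum poly_monom)
  finally show "poly f 1 = coeff h 0 + int (q - 1) * coeff h 1"
    using q_gt_1 by (simp add: of_nat_diff algebra_simps)
qed

text \<open>\<open>f(1) = 0\<close> makes the constant coefficient \<open>-(q - 1) c\<close>, with
  \<open>c\<close> the common other one; the integer value is then \<open>-q c\<close>.\<close>

lemma invariant_cong_multiple:
  fixes f :: "int poly"
  assumes "ideal_cong 0 (monom 1 q - 1) (pcompose f (monom 1 g)) f" "poly f 1 = 0"
  shows "\<exists>c. ideal_cong 0 (all_one_poly q) f (of_int (int q * c))"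
proof -
  obtain h where h: "degree h < q" "ideal_cong 0 (monom (1::int) q - 1) f h"
    using ex_reduced[of q f] q_gt_1 by auto
  have "coeff h 0 - coeff h 1 = int q * (- coeff h 1)"
    using invariant_cong_int(2)[OF assms(1) h(2,1)] assms(2) q_gt_1 
    by (simp add: of_nat_diff algebra_simps)
  then show ?thesis using invariant_cong_int(1)[OF assms(1) h(2,1)] by metis
qed

end

section \<open>Cubic Gaussian periods\<close>

locale cubic_periods = primitive_root +
  fixes k :: nat
  assumes q_eq: "q = 3 * k + 1"
begin

text \<open>Sum of the powers of \<open>x\<close> over the coset of the cubes represented by
  \<open>g^i\<close>. Exponents stay unreduced, so dependence on \<open>i mod 3\<close> alone holds
  only modulo \<open>x^q - 1\<close>.\<close>

definition period :: "nat \<Rightarrow> int poly"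
  where "period i = (\<Sum>j<k. monom 1 (g ^ (3 * j + i)))"

definition period_diff :: "nat \<Rightarrow> int poly"
  where "period_diff i = period i - period (i + 1)"

lemma k_pos: "k > 0"
  using q_gt_1 q_eq by simp

lemma power_g_cong_iff_k: "[g ^ a = g ^ b] (mod q) \<longleftrightarrow> [a = b] (mod (3 * k))"
  using power_g_cong_iff by (simp add: q_eq)

text \<open>Raising the index by 3 trades the summand \<open>j = 0\<close> for \<open>j = k\<close>;
  these agree because \<open>g^(3 k)\<close> is 1 modulo \<open>q\<close>.\<close>

lemma period_cong_add: "ideal_cong 0 (monom 1 q - 1) (period (i + 3 * n)) (period i)"
proof (induction n)
  case (Suc n)
  let ?f = "\<lambda>j. monom (1::int) (g ^ (3 * j + (i + 3 * n)))"
  have "period (i + 3 * Suc n) = (\<Sum>j<k. ?f (Suc j))"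
    by (simp add: period_def algebra_simps)
  also have "\<dots> = (\<Sum>j<k. ?f j) - ?f 0 + ?f k"
    using sum.lessThan_Suc_shift[of ?f k] sum.lessThan_Suc[of ?f k] by simp
  also have "(\<Sum>j<k. ?f j) = period (i + 3 * n)" by (simp add: period_def)
  also have "ideal_cong 0 (monom 1 q - 1) (period (i + 3 * n) - ?f 0 + ?f k)
      (period (i + 3 * n) - ?f 0 + ?f 0)"
    by (intro ideal_cong_add ideal_cong_refl ideal_cong_monom iffD2[OF power_g_cong_iff_k])
       (simp add: cong_def)
  finally show ?case using Suc by (simp add: ideal_cong_trans)
qed simp

lemma period_cong:
  assumes "[i = j] (mod 3)"
  shows "ideal_cong 0 (monom 1 q - 1) (period i) (period j)"
proof -
  have "ideal_cong 0 (monom 1 q - 1) (period n) (period (n mod 3))" for n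
    using period_cong_add[of "n mod 3" "n div 3"] by simp
  from ideal_cong_trans[OF this[of i] ideal_cong_sym] this[of j] assms
  show ?thesis by (simp add: cong_def)
qed

lemma period_diff_cong:
  assumes "[i = j] (mod 3)"
  shows "ideal_cong 0 (monom 1 q - 1) (period_diff i) (period_diff j)"
  unfolding period_diff_def using assms
  by (intro ideal_cong_diff period_cong cong_add) auto

text \<open>Multiplying exponents by \<open>g^m\<close> shifts the coset. The case
  \<open>a = g\<close> yields invariance of cyclic expressions, the case \<open>a = p\<close> the
  action of Frobenius.\<close>

lemma pcompose_period_diff:
  assumes "[a = g ^ m] (mod q)"
  shows "ideal_cong 0 (monom 1 q - 1) (pcompose (period_diff i) (monom 1 a)) (period_diff (i + m))"
proof -
  have "ideal_cong 0 (monom 1 q - 1) (pcompose (period i) (monom 1 a)) (period (i + m))" for i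
  proof -
    have "[g ^ n * a = g ^ (n + m)] (mod q)" for n
      unfolding power_add using assms by (intro cong_mult) auto
    then show ?thesis
      unfolding period_def pcompose_sum pcompose_monom_monom
      by (intro ideal_cong_sum ideal_cong_monom) (simp add: add.assoc[symmetric])
  qed
  from ideal_cong_diff[OF this[of i] this[of "i + 1"]] show ?thesis
    by (simp add: period_diff_def pcompose_diff)
qed

lemma poly_period_diff_1 [simp]: "poly (period_diff i) 1 = 0"
  by (simp add: period_diff_def period_def poly_sum poly_monom)

lemma period_diff_sum: 
  "ideal_cong 0 (monom 1 q - 1) (period_diff 0 + period_diff 1 + period_diff 2) 0"
proof -
  have "ideal_cong 0 (monom 1 q - 1) (period 0 - period 3) (period 0 - period 0)"
    by (intro ideal_cong_diff period_cong) (auto simp: cong_def)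
  then show ?thesis by (simp add: period_diff_def numeral_2_eq_2 numeral_3_eq_3)
qed

lemma pcompose_period_diffs:
  "ideal_cong 0 (monom 1 q - 1) (pcompose (period_diff 0) (monom 1 g)) (period_diff 1)"
  "ideal_cong 0 (monom 1 q - 1) (pcompose (period_diff 1) (monom 1 g)) (period_diff 2)"
  "ideal_cong 0 (monom 1 q - 1) (pcompose (period_diff 2) (monom 1 g)) (period_diff 0)"
proof -
  have *: "ideal_cong 0 (monom 1 q - 1) (pcompose (period_diff i) (monom 1 g)) (period_diff (i + 1))" for i
    by (rule pcompose_period_diff) simp
  show "ideal_cong 0 (monom 1 q - 1) (pcompose (period_diff 0) (monom 1 g)) (period_diff 1)"
    using *[of 0] by simp
  show "ideal_cong 0 (monom 1 q - 1) (pcompose (period_diff 1) (monom 1 g)) (period_diff 2)"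
    using *[of 1] by (simp add: numeral_2_eq_2)
  have "ideal_cong 0 (monom 1 q - 1) (period_diff (2 + 1)) (period_diff 0)"
    by (rule period_diff_cong) (simp add: cong_def)
  then show "ideal_cong 0 (monom 1 q - 1) (pcompose (period_diff 2) (monom 1 g)) (period_diff 0)"
    using *[of 2] ideal_cong_trans by blast
qed

text \<open>If \<open>-1\<close> is \<open>g^s\<close>, then \<open>-1 = (-1)^3\<close> is
  \<open>g^(3 s)\<close>; \<open>q - 1\<close> stands for \<open>-1\<close> in the naturals.\<close>

lemma ex_minus_1_power: "\<exists>s. q dvd g ^ (3 * s) + 1"
proof -
  have "\<not> q dvd q - 1" using q_gt_1 by (auto dest: dvd_imp_le)
  then obtain s where "[q - 1 = g ^ s] (mod q)" using ex_power_g by blast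
  then have "[(q - 1) ^ 3 + 1 = g ^ (3 * s) + 1] (mod q)"
    using cong_pow[of "q - 1" "g ^ s" q 3] by (intro cong_add) (auto simp: power_mult mult.commute)
  moreover have "q dvd (q - 1) ^ 3 + 1"
  proof -
    have "int ((q - 1) ^ 3 + 1) = int q * (int q ^ 2 - 3 * int q + 3)"
    proof -
      have "int (q - 1) = int q - 1" using q_gt_1 by simp
      then have "int ((q - 1) ^ 3 + 1) = (int q - 1) ^ 3 + 1" by (simp only: of_nat_add of_nat_power of_nat_1)
      then show ?thesis by (simp add: power2_eq_square power3_eq_cube algebra_simps)
    qed
    then show ?thesis by (metis dvd_triv_left of_nat_dvd_iff)
  qed
  ultimately show ?thesis by (metis cong_dvd_iff)
qed

text \<open>Counts the coefficient of \<open>1\<close> in a product of two periods: since \<open>- 1\<close> is a cube,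
  it vanishes unless the periods belong to the same coset of the cubes.\<close>

lemma card_opposite:
  assumes "i < 3" "j < 3"
  shows "(\<Sum>u<k. \<Sum>v<k. if q dvd g ^ (3 * u + i) + g ^ (3 * v + j) then 1 else 0) =
    (if i = j then int k else 0)"
proof -
  obtain s where s: "q dvd g ^ (3 * s) + 1" using ex_minus_1_power by blast
  have "q dvd g ^ (3 * u + i) + g ^ (3 * v + j) \<longleftrightarrow> i = j \<and> u = (s + v) mod k"
    if "u < k" for u v
  proof -
    \<comment> \<open>\<open>g^(3 (s + v) + j)\<close> is the negative of
      \<open>g^(3 v + j)\<close>, so the divisibility becomes an equality of powers of
      \<open>g\<close>, decided by exponents modulo \<open>3 k\<close>.\<close>
    have eq: "g ^ (3 * (s + v) + j) + g ^ (3 * v + j) = (g ^ (3 * s) + 1) * g ^ (3 * v + j)"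
      by (simp add: distrib_right add.assoc flip: power_add)
    have "q dvd g ^ (3 * (s + v) + j) + g ^ (3 * v + j)"
      unfolding eq using s by (rule dvd_mult2)
    then have *: "[0 = g ^ (3 * (s + v) + j) + g ^ (3 * v + j)] (mod q)"
      unfolding cong_sym_eq[of 0] cong_0_iff .
    have "q dvd g ^ (3 * u + i) + g ^ (3 * v + j) \<longleftrightarrow>
        [g ^ (3 * u + i) + g ^ (3 * v + j) = g ^ (3 * (s + v) + j) + g ^ (3 * v + j)] (mod q)"
      unfolding cong_0_iff[symmetric] using cong_trans[OF _ *] cong_trans[OF _ cong_sym[OF *]]
      by (rule iffI)
    also have "\<dots> \<longleftrightarrow> [3 * u + i = 3 * (s + v) + j] (mod (3 * k))"
      by (simp add: cong_add_rcancel_nat power_g_cong_iff_k)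
    also have "\<dots> \<longleftrightarrow> i = j \<and> [3 * u = 3 * (s + v)] (mod (3 * k))"
    proof
      assume *: "[3 * u + i = 3 * (s + v) + j] (mod (3 * k))"
      then have "[3 * u + i = 3 * (s + v) + j] (mod 3)" by (rule cong_dvd_modulus_nat) simp
      moreover have "(3 * x + y) mod 3 = y" if "y < 3" for x y :: nat using that by simp
      ultimately have "i = j" using assms unfolding cong_def by metis
      then show "i = j \<and> [3 * u = 3 * (s + v)] (mod (3 * k))"
        using * by (simp add: cong_add_rcancel_nat)
    qed (auto simp: cong_add_rcancel_nat)
    also have "[3 * u = 3 * (s + v)] (mod (3 * k)) \<longleftrightarrow> u = (s + v) mod k"
      unfolding cong_def mult_mod_right[symmetric] using that by simp
    finally show ?thesis .
  qed
  then have "(\<Sum>v<k. \<Sum>u<k. if q dvd g ^ (3 * u + i) + g ^ (3 * v + j) then 1 else 0) =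
      (\<Sum>v<k. \<Sum>u<k. if u = (s + v) mod k then if i = j then 1 else 0 else (0::int))"
    by (intro sum.cong refl) simp
  also have "\<dots> = (\<Sum>v<k. if i = j then 1 else 0)" using k_pos by (intro sum.cong refl) simp
  finally show ?thesis by (subst sum.swap) simp
qed

text \<open>Reducing exponents modulo \<open>q\<close> gives a representative whose constant
  coefficient counts the pairs of exponents with sum divisible by \<open>q\<close>.\<close>

lemma period_mult:
  assumes "i < 3" "j < 3"
  shows "\<exists>h. degree h < q \<and> ideal_cong 0 (monom 1 q - 1) (period i * period j) h \<and>
    coeff h 0 = (if i = j then int k else 0)"
proof (intro exI conjI)
  let ?h = "\<Sum>u<k. \<Sum>v<k. monom (1::int) ((g ^ (3 * u + i) + g ^ (3 * v + j)) mod q)"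
  show "degree ?h < q"
    using q_gt_1 by (intro degree_sum_less) (auto intro!: le_less_trans[OF degree_monom_le])
  have eq: "period i * period j = (\<Sum>u<k. \<Sum>v<k. monom 1 (g ^ (3 * u + i) + g ^ (3 * v + j)))"
    by (simp add: period_def sum_product mult_monom)
  show "ideal_cong 0 (monom 1 q - 1) (period i * period j) ?h"
    unfolding eq by (intro ideal_cong_sum ideal_cong_monom) (simp add: cong_def)
  have "coeff ?h 0 = (\<Sum>u<k. \<Sum>v<k. if q dvd g ^ (3 * u + i) + g ^ (3 * v + j) then 1 else 0)"
    by (simp add: coeff_sum mod_eq_0_iff_dvd)
  then show "coeff ?h 0 = (if i = j then int k else 0)" using card_opposite[OF assms] by simp
qed

text \<open>Expanded, this is the sum of the mixed products of periods minus their squares. Only the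
  squares meet the constant coefficient, giving \<open>-3 k = -(q - 1)\<close>. Vanishing at 1 makes
  the other coefficients 1, so the value is \<open>-q\<close>.\<close>

lemma period_diff_sym2:
  "ideal_cong 0 (all_one_poly q)
    (period_diff 0 * period_diff 1 + period_diff 1 * period_diff 2 + period_diff 2 * period_diff 0)
    (of_int (- int q))" (is "ideal_cong 0 _ ?E _")
proof -
  obtain h00 where h00: "degree h00 < q" "ideal_cong 0 (monom 1 q - 1) (period 0 * period 0) h00"
      "coeff h00 0 = int k" using period_mult[of 0 0] by auto
  obtain h11 where h11: "degree h11 < q" "ideal_cong 0 (monom 1 q - 1) (period 1 * period 1) h11"
      "coeff h11 0 = int k" using period_mult[of 1 1] by auto
  obtain h22 where h22: "degree h22 < q" "ideal_cong 0 (monom 1 q - 1) (period 2 * period 2) h22"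
      "coeff h22 0 = int k" using period_mult[of 2 2] by auto
  obtain h01 where h01: "degree h01 < q" "ideal_cong 0 (monom 1 q - 1) (period 0 * period 1) h01"
      "coeff h01 0 = 0" using period_mult[of 0 1] by auto
  obtain h12 where h12: "degree h12 < q" "ideal_cong 0 (monom 1 q - 1) (period 1 * period 2) h12"
      "coeff h12 0 = 0" using period_mult[of 1 2] by auto
  obtain h20 where h20: "degree h20 < q" "ideal_cong 0 (monom 1 q - 1) (period 2 * period 0) h20"
      "coeff h20 0 = 0" using period_mult[of 2 0] by auto
  define h where "h = h01 + h12 + h20 - h00 - h11 - h22"
  have deg: "degree h < q"
    unfolding h_def using h00 h11 h22 h01 h12 h20 
    by (intro degree_diff_less degree_add_less)
  have h0: "coeff h 0 = - int (q - 1)" unfolding h_def using h00 h11 h22 h01 h12 h20 q_eq by simp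
  have d: "period_diff 0 = period 0 - period 1" "period_diff 1 = period 1 - period 2"
    "ideal_cong 0 (monom 1 q - 1) (period_diff 2) (period 2 - period 0)"
    unfolding period_diff_def 
    by (auto simp: numeral_2_eq_2 cong_def intro!: ideal_cong_diff period_cong)
  have "ideal_cong 0 (monom 1 q - 1) ?E
      ((period 0 - period 1) * (period 1 - period 2) + (period 1 - period 2) * (period 2 - period 0)
        + (period 2 - period 0) * (period 0 - period 1))"
    using d(3) unfolding d(1,2) by (intro ideal_cong_add ideal_cong_mult ideal_cong_refl)
  also have "\<dots> = period 0 * period 1 + period 1 * period 2 + period 2 * period 0
      - period 0 * period 0 - period 1 * period 1 - period 2 * period 2"
    by (simp add: algebra_simps)
  also have "ideal_cong 0 (monom 1 q - 1) \<dots> h"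
    unfolding h_def by (intro ideal_cong_add ideal_cong_diff h00 h11 h22 h01 h12 h20)
  finally have Eh: "ideal_cong 0 (monom 1 q - 1) ?E h" .
  have "ideal_cong 0 (monom 1 q - 1) (pcompose ?E (monom 1 g))
      (period_diff 1 * period_diff 2 + period_diff 2 * period_diff 0 + period_diff 0 * period_diff 1)"
    unfolding pcompose_add pcompose_mult
    by (intro ideal_cong_add ideal_cong_mult pcompose_period_diffs)
  then have inv: "ideal_cong 0 (monom 1 q - 1) (pcompose ?E (monom 1 g)) ?E"
    by (simp add: add_ac)
  have "int (q - 1) * (coeff h 1 - 1) = 0"
    using invariant_cong_int(2)[OF inv Eh deg] h0 by (simp add: algebra_simps)
  then have "coeff h 1 = 1" using q_gt_1 by simp
  then have "coeff h 0 - coeff h 1 = - int q" using h0 q_gt_1 by (simp add: of_nat_diff)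
  then show ?thesis using invariant_cong_int(1)[OF inv Eh deg] by metis
qed

text \<open>The product is unchanged by a cyclic shift and vanishes at 1.\<close>

lemma period_diff_sym3:
  "\<exists>b. ideal_cong 0 (all_one_poly q) (period_diff 0 * period_diff 1 * period_diff 2) (of_int (int q * b))"
    (is "\<exists>b. ideal_cong 0 _ ?E _")
proof (rule invariant_cong_multiple)
  have "ideal_cong 0 (monom 1 q - 1) (pcompose ?E (monom 1 g))
      (period_diff 1 * period_diff 2 * period_diff 0)"
    unfolding pcompose_mult by (intro ideal_cong_mult pcompose_period_diffs)
  then show "ideal_cong 0 (monom 1 q - 1) (pcompose ?E (monom 1 g)) ?E"
    by (simp add: mult_ac)
qed simp

text \<open>A cyclic shift is an even permutation, so this square root of the discriminant is
  invariant too.\<close>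

lemma period_diff_vandermonde:
  "\<exists>a. ideal_cong 0 (all_one_poly q) ((period_diff 0 - period_diff 1) *
    (period_diff 1 - period_diff 2) * (period_diff 2 - period_diff 0)) (of_int (int q * a))"
    (is "\<exists>a. ideal_cong 0 _ ?W _")
proof (rule invariant_cong_multiple)
  have "ideal_cong 0 (monom 1 q - 1) (pcompose ?W (monom 1 g)) ((period_diff 1 - period_diff 2) *
    (period_diff 2 - period_diff 0) * (period_diff 0 - period_diff 1))"
    unfolding pcompose_mult pcompose_diff
    by (intro ideal_cong_mult ideal_cong_diff pcompose_period_diffs)
  then show "ideal_cong 0 (monom 1 q - 1) (pcompose ?W (monom 1 g)) ?W"
    by (simp only: mult_ac)
qed simp

end

section \<open>The discriminant and the representation \<open>4 q = a^2 + 27 b^2\<close>\<close>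

text \<open>The cubic discriminant in elementary symmetric functions, with the terms divisible by
  \<open>x + y + z\<close> collected first, as they vanish for the period differences.\<close>

lemma discriminant_identity:
  fixes x y z :: "'a::comm_ring_1"
  shows "((x - y) * (y - z) * (z - x)) ^ 2 =
    (x + y + z) * ((x + y + z) * (x * y + y * z + z * x) ^ 2 - 4 * (x + y + z) ^ 2 * (x * y * z)
      + 18 * (x * y + y * z + z * x) * (x * y * z))
    - 4 * (x * y + y * z + z * x) ^ 3 - 27 * (x * y * z) ^ 2"
  by (simp add: power2_eq_square power3_eq_cube algebra_simps)

lemma vieta_cubic:
  fixes t x y z :: "'a::comm_ring_1"
  shows "(t - x) * (t - y) * (t - z) =
    t ^ 3 - (x + y + z) * t ^ 2 + (x * y + y * z + z * x) * t - x * y * z"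
  by (simp add: power2_eq_square power3_eq_cube algebra_simps)

context cubic_periods
begin

lemma lead_coeff_all_one: "lead_coeff (all_one_poly q) = 1"
  using q_gt_1 by (intro lead_coeff_all_one_poly) simp

lemma degree_all_one: "degree (all_one_poly q) > 0"
  using q_gt_1 by (simp add: degree_all_one_poly)

text \<open>The symmetric functions \<open>0\<close>, \<open>-q\<close>, \<open>q b\<close> and the
  Vandermonde value \<open>q a\<close> turn the discriminant identity into
  \<open>q^2 a^2 = 4 q^3 - 27 q^2 b^2\<close>.\<close>

lemma ex_norm_form_and_sym3:
  "\<exists>a b. 4 * int q = a ^ 2 + 27 * b ^ 2 \<and> ideal_cong 0 (all_one_poly q)
    (period_diff 0 * period_diff 1 * period_diff 2) (of_int (int q * b))"
proof -
  let ?d0 = "period_diff 0" and ?d1 = "period_diff 1" and ?d2 = "period_diff 2"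
  let ?Q = "int q"
  let ?C = "ideal_cong 0 (all_one_poly q)"
  define e1 e2 e3 where e: "e1 = ?d0 + ?d1 + ?d2" "e2 = ?d0 * ?d1 + ?d1 * ?d2 + ?d2 * ?d0"
    "e3 = ?d0 * ?d1 * ?d2"
  define w where "w = (?d0 - ?d1) * (?d1 - ?d2) * (?d2 - ?d0)"
  obtain b where b: "?C e3 (of_int (?Q * b))" using period_diff_sym3 unfolding e by blast
  obtain a where a: "?C w (of_int (?Q * a))" using period_diff_vandermonde unfolding w_def by blast
  have e1: "?C e1 0" unfolding e using period_diff_sum all_one_poly_dvd by (rule ideal_cong_mono)
  have e2: "?C e2 (of_int (- ?Q))" unfolding e by (rule period_diff_sym2)
  have disc: "w ^ 2 = e1 * (e1 * e2 ^ 2 - 4 * e1 ^ 2 * e3 + 18 * e2 * e3) - 4 * e2 ^ 3 - 27 * e3 ^ 2"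
    unfolding w_def e by (rule discriminant_identity)
  have "?C (w ^ 2) (0 * (e1 * e2 ^ 2 - 4 * e1 ^ 2 * e3 + 18 * e2 * e3)
      - 4 * of_int (- ?Q) ^ 3 - 27 * of_int (?Q * b) ^ 2)"
    unfolding disc by (intro ideal_cong_diff ideal_cong_mult ideal_cong_power ideal_cong_refl e1 e2 b)
  then have "?C (of_int (?Q * a) ^ 2) (- 4 * of_int (- ?Q) ^ 3 - 27 * of_int (?Q * b) ^ 2)"
    using ideal_cong_trans[OF ideal_cong_sym[OF ideal_cong_power[OF a]]] by simp
  \<comment> \<open>Divisibility by \<open>0\<close> makes this an equality of integers.\<close>
  then have "ideal_cong (of_int 0) (all_one_poly q) (of_int ((?Q * a) ^ 2))
      (of_int (- 4 * (- ?Q) ^ 3 - 27 * (?Q * b) ^ 2))"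
    by simp
  from ideal_cong_const_dvd[OF this lead_coeff_all_one degree_all_one]
  have "(?Q * a) ^ 2 = - 4 * (- ?Q) ^ 3 - 27 * (?Q * b) ^ 2" by simp
  then have "?Q ^ 2 * (4 * ?Q) = ?Q ^ 2 * (a ^ 2 + 27 * b ^ 2)"
    by (simp add: power2_eq_square power3_eq_cube algebra_simps)
  then have "4 * ?Q = a ^ 2 + 27 * b ^ 2" using q_gt_1 by simp
  with b show ?thesis unfolding e by blast
qed

section \<open>Reduction modulo \<open>p\<close>: roots of the cubic and the class of
  \<open>p\<close>\<close>

context
  fixes p m :: nat and b :: int
  assumes prime_p: "prime p" and p_cong: "[p = g ^ m] (mod q)"
    and sym3: "ideal_cong 0 (all_one_poly q)
      (period_diff 0 * period_diff 1 * period_diff 2) (of_int (int q * b))"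
begin

abbreviation cong_p :: "int poly \<Rightarrow> int poly \<Rightarrow> bool"
  where "cong_p \<equiv> ideal_cong (of_nat p) (all_one_poly q)"

lemma cong_pI: "ideal_cong 0 (all_one_poly q) x y \<Longrightarrow> cong_p x y"
  by (erule ideal_cong_mono) simp

lemma cong_pI': "ideal_cong 0 (monom 1 q - 1) x y \<Longrightarrow> cong_p x y"
  by (erule ideal_cong_mono) (rule all_one_poly_dvd)

lemma cong_p_int_iff: "cong_p (of_int x) (of_int y) \<longleftrightarrow> int p dvd x - y"
proof
  assume "cong_p (of_int x) (of_int y)"
  then show "int p dvd x - y"
    using ideal_cong_const_dvd[of "int p", OF _ lead_coeff_all_one degree_all_one] by simp
next
  assume "int p dvd x - y"
  then obtain c where "x - y = int p * c" by (rule dvdE)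
  then have "(of_int (x - y) :: int poly) = of_nat p * of_int c"
    by (metis of_int_mult of_int_of_nat_eq)
  then show "cong_p (of_int x) (of_int y)" by (intro ideal_cong_dvd_left) simp
qed

lemma cubic_cong:
  "cong_p ((of_int x - period_diff 0) * (of_int x - period_diff 1) * (of_int x - period_diff 2))
    (of_int (x ^ 3 - int q * x - int q * b))"
proof -
  let ?d0 = "period_diff 0" and ?d1 = "period_diff 1" and ?d2 = "period_diff 2"
  have "(of_int x - ?d0) * (of_int x - ?d1) * (of_int x - ?d2) =
      of_int x ^ 3 - (?d0 + ?d1 + ?d2) * of_int x ^ 2
        + (?d0 * ?d1 + ?d1 * ?d2 + ?d2 * ?d0) * of_int x - ?d0 * ?d1 * ?d2"
    by (rule vieta_cubic)
  moreover have "cong_p \<dots>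
      (of_int x ^ 3 - 0 * of_int x ^ 2 + of_int (- int q) * of_int x - of_int (int q * b))"
    by (intro ideal_cong_add ideal_cong_diff ideal_cong_mult ideal_cong_refl
        cong_pI[OF period_diff_sym2] cong_pI[OF sym3] cong_pI'[OF period_diff_sum])
  ultimately show ?thesis by simp
qed

lemma frobenius: "cong_p ((of_int x - period_diff i) ^ p) (of_int x - period_diff (i + m))"
proof -
  have "cong_p ((of_int x - period_diff i) ^ p)
      (pcompose (of_int x - period_diff i) (monom 1 p))"
    using prime_p by (rule ideal_cong_frobenius)
  also have "pcompose (of_int x - period_diff i) (monom 1 p) =
      of_int x - pcompose (period_diff i) (monom 1 p)"
    by (simp add: pcompose_diff)
  also have "cong_p \<dots> (of_int x - period_diff (i + m))"
    by (intro ideal_cong_diff ideal_cong_refl cong_pI' pcompose_period_diff p_cong)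
  finally show ?thesis .
qed

text \<open>If Frobenius fixes the root \<open>d\<close>, then \<open>\<Prod>\<^sub>j (d - j) = d\<^sup>p - d = 0\<close>, and this product
  divides the product of the values of the cubic at all residues \<open>j\<close>.\<close>

lemma ex_root_if_cube:
  assumes "3 dvd m"
  shows "\<exists>x. int p dvd x ^ 3 - int q * x - int q * b"
proof -
  let ?F = "\<lambda>x. x ^ 3 - int q * x - int q * b"
  let ?d = "period_diff"
  have "cong_p (?d 0 ^ p) (?d 0)"
  proof -
    have 1: "cong_p (?d 0 ^ p) (pcompose (?d 0) (monom 1 p))"
      using prime_p by (rule ideal_cong_frobenius)
    have 2: "cong_p (pcompose (?d 0) (monom 1 p)) (?d (0 + m))"
      by (intro cong_pI' pcompose_period_diff p_cong)
    have 3: "cong_p (?d (0 + m)) (?d 0)"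
      using assms by (intro cong_pI' period_diff_cong) (simp add: cong_0_iff)
    show ?thesis using ideal_cong_trans[OF 1 ideal_cong_trans[OF 2 3]] .
  qed
  then have "cong_p (?d 0 ^ p - ?d 0) (?d 0 - ?d 0)" by (intro ideal_cong_diff ideal_cong_refl)
  moreover have "cong_p (\<Prod>j<p. ?d 0 - of_nat j) (?d 0 ^ p - ?d 0)"
    by (intro ideal_cong_sym[OF ideal_cong_dvd_left] dvd_power_minus_self_minus_prod prime_p)
  ultimately have "cong_p (\<Prod>j<p. ?d 0 - of_nat j) (?d 0 - ?d 0)"
    using ideal_cong_trans by blast
  then have zero: "cong_p (\<Prod>j<p. ?d 0 - of_nat j) 0" by simp
  have "cong_p (of_int (\<Prod>j<p. ?F (int j)))
      (\<Prod>j<p. (of_int (int j) - ?d 0) * (of_int (int j) - ?d 1) * (of_int (int j) - ?d 2))"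
    unfolding of_int_prod by (intro ideal_cong_prod ideal_cong_sym[OF cubic_cong])
  \<comment> \<open>The sign in the second product turns each \<open>j - d\<^sub>0\<close> into
    \<open>d\<^sub>0 - j\<close>.\<close>
  also have "\<dots> = (\<Prod>j<p. ?d 0 - of_nat j) *
      (\<Prod>j<p. - ((of_int (int j) - ?d 1) * (of_int (int j) - ?d 2)))"
    unfolding prod.distrib[symmetric] by (intro prod.cong refl) (simp add: algebra_simps)
  also have "cong_p \<dots> (0 * (\<Prod>j<p. - ((of_int (int j) - ?d 1) * (of_int (int j) - ?d 2))))"
    by (intro ideal_cong_mult zero ideal_cong_refl)
  finally have "cong_p (of_int (\<Prod>j<p. ?F (int j))) (of_int 0)" by simp
  then have "int p dvd (\<Prod>j<p. ?F (int j))" unfolding cong_p_int_iff by simp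
  then obtain j where "int p dvd ?F (int j)"
    using prime_p by (subst (asm) prime_dvd_prod_iff) auto
  then show ?thesis by blast
qed

text \<open>If Frobenius permutes the three factors \<open>x - d\<^sub>i\<close> of \<open>0\<close> cyclically, then \<open>z = x - d\<^sub>0\<close>
  satisfies \<open>z\<^bsup>1+p+pp\<^esup> = 0\<close> and \<open>z\<^bsup>ppp\<^esup> = z\<close>, hence \<open>z = 0\<close>.\<close>

lemma cube_if_root:
  assumes "p \<noteq> 3" "p \<noteq> q" "int p dvd x ^ 3 - int q * x - int q * b"
  shows "3 dvd m"
proof (rule ccontr)
  assume "\<not> 3 dvd m"
  \<comment> \<open>The indices \<open>0\<close>, \<open>m\<close>, \<open>2 m\<close> run through
    all classes modulo 3.\<close>
  then have m_cases: "m mod 3 = 1 \<and> (2 * m) mod 3 = 2 \<or> m mod 3 = 2 \<and> (2 * m) mod 3 = 1"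
    by presburger
  define z where "z i = of_int x - period_diff i" for i
  have z_cong: "cong_p (z i) (z j)" if "[i = j] (mod 3)" for i j
    unfolding z_def by (intro ideal_cong_diff ideal_cong_refl cong_pI' period_diff_cong that)
  have frob: "cong_p (z i ^ p) (z (i + m))" for i
    unfolding z_def by (rule frobenius)
  have z1: "cong_p (z 0 ^ p) (z m)" using frob[of 0] by simp
  have z2: "cong_p (z 0 ^ (p * p)) (z (2 * m))"
    using ideal_cong_trans[OF ideal_cong_power[OF z1, of p] frob[of m]]
    by (simp add: power_mult mult_2)
  have z3: "cong_p (z 0 ^ (p * p * p)) (z 0)"
    using ideal_cong_trans[OF ideal_cong_power[OF z2, of p]
        ideal_cong_trans[OF frob[of "2 * m"] z_cong[of "2 * m + m" 0]]]
    by (simp add: power_mult cong_0_iff)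
  have "cong_p (z 0 * z 1 * z 2) (of_int (x ^ 3 - int q * x - int q * b))"
    unfolding z_def by (rule cubic_cong)
  also have "cong_p \<dots> (of_int 0)" unfolding cong_p_int_iff using assms(3) by simp
  finally have z012: "cong_p (z 0 * z 1 * z 2) 0" by simp
  have z0m: "cong_p (z 0 * z m * z (2 * m)) (z 0 * z 1 * z 2)"
  proof -
    from m_cases consider "[m = 1] (mod 3)" "[2 * m = 2] (mod 3)" | "[m = 2] (mod 3)" "[2 * m = 1] (mod 3)"
      by (auto simp: cong_def)
    then show ?thesis
    proof cases
      case 1
      then show ?thesis by (intro ideal_cong_mult ideal_cong_refl z_cong)
    next
      case 2
      then have "cong_p (z 0 * z m * z (2 * m)) (z 0 * z 2 * z 1)"
        by (intro ideal_cong_mult ideal_cong_refl z_cong)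
      then show ?thesis by (simp add: mult.commute mult.left_commute)
    qed
  qed
  have "cong_p (z 0 * z 0 ^ p * z 0 ^ (p * p)) (z 0 * z m * z (2 * m))"
    by (intro ideal_cong_mult ideal_cong_refl z1 z2)
  from ideal_cong_trans[OF this ideal_cong_trans[OF z0m z012]]
  have "cong_p (z 0 * z 0 ^ p * z 0 ^ (p * p)) 0" .
  then have nil: "cong_p (z 0 ^ (1 + p + p * p)) 0" by (simp add: power_add mult.assoc)
  have "1 + p + p * p \<le> p * p * p"
  proof -
    have p2: "p \<ge> 2" using prime_p prime_ge_2_nat by blast
    then have "2 * (p * p) \<le> p * p * p" "2 * p \<le> p * p" by auto
    with p2 show ?thesis by linarith
  qed
  then have "z 0 ^ (p * p * p) = z 0 ^ (1 + p + p * p) * z 0 ^ (p * p * p - (1 + p + p * p))"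
    by (metis le_add_diff_inverse power_add)
  then have "cong_p (z 0 ^ (p * p * p)) (0 * z 0 ^ (p * p * p - (1 + p + p * p)))"
    using ideal_cong_mult[OF nil ideal_cong_refl] by metis
  then have c0: "cong_p (z 0) 0" using ideal_cong_trans[OF ideal_cong_sym[OF z3]] by simp
  have p0: "p > 0" using prime_p prime_gt_0_nat by blast
  \<comment> \<open>The other factors are congruent to powers of \<open>z 0\<close>.\<close>
  have cm: "cong_p (z m) 0"
    using ideal_cong_trans[OF ideal_cong_sym[OF z1] ideal_cong_power[OF c0]] p0 by (simp add: zero_power)
  have c2m: "cong_p (z (2 * m)) 0"
    using ideal_cong_trans[OF ideal_cong_sym[OF z2] ideal_cong_power[OF c0]] p0 by (simp add: zero_power)
  have c: "cong_p (z i) 0" for i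
  proof -
    have "i mod 3 = 0 \<or> i mod 3 = m mod 3 \<or> i mod 3 = (2 * m) mod 3"
    proof -
      have "i mod 3 = 0 \<or> i mod 3 = 1 \<or> i mod 3 = 2" by linarith
      then show ?thesis using m_cases by (elim disjE conjE) simp_all
    qed
    then have "[i = 0] (mod 3) \<or> [i = m] (mod 3) \<or> [i = 2 * m] (mod 3)" by (simp add: cong_def)
    then show ?thesis
      using ideal_cong_trans[OF z_cong c0] ideal_cong_trans[OF z_cong cm]
        ideal_cong_trans[OF z_cong c2m] by (elim disjE)
  qed
  \<comment> \<open>All three roots equal \<open>x\<close>: the vanishing sum gives
    \<open>3 x = 0\<close>, hence \<open>x = 0\<close>, and the second symmetric function gives
    \<open>3 x^2 = -q\<close>, so \<open>p\<close> would divide \<open>q\<close>.\<close>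
  have d: "cong_p (of_int x) (period_diff i)" for i
    using ideal_cong_add[OF c[of i] ideal_cong_refl[of _ _ "period_diff i"]] by (simp add: z_def)
  have "cong_p (of_int x + of_int x + of_int x) 0"
    using ideal_cong_trans[OF ideal_cong_add[OF ideal_cong_add[OF d[of 0] d[of 1]] d[of 2]]
        cong_pI'[OF period_diff_sum]] .
  then have "cong_p (of_int (3 * x)) (of_int 0)" by simp
  then have "int p dvd 3 * x" unfolding cong_p_int_iff by simp
  moreover have "\<not> int p dvd 3"
  proof
    assume "int p dvd 3"
    then have "p dvd 3" by (metis of_nat_dvd_iff of_nat_numeral)
    then show False using assms(1) prime_p primes_dvd_imp_eq[of p 3] by simp
  qed
  ultimately have px: "int p dvd x" using prime_p prime_dvd_mult_iff[of "int p" 3 x] by simp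
  have "cong_p (of_int x * of_int x + of_int x * of_int x + of_int x * of_int x) (of_int (- int q))"
    by (rule ideal_cong_trans[OF _ cong_pI[OF period_diff_sym2]])
      (intro ideal_cong_add ideal_cong_mult d)
  then have "cong_p (of_int (3 * (x * x))) (of_int (- int q))" by simp
  then have "int p dvd 3 * (x * x) + int q" unfolding cong_p_int_iff by simp
  then have "int p dvd int q" using px by (simp add: dvd_add_right_iff)
  then show False using assms(2) prime_p prime_q primes_dvd_imp_eq by auto
qed

end

end

section \<open>Counting the roots modulo \<open>p\<close>\<close>

text \<open>Multiplying the two forms gives
  \<open>16 q^2 = (a L + 27 b M)^2 + 27 (b L - a M)^2\<close>. Up to the sign of \<open>a\<close>,
  \<open>q\<close> divides \<open>b L - a M\<close>, which must be 0 as \<open>27 > 16\<close>; then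
  \<open>b^2 = M^2\<close>.\<close>

lemma norm_form_unique:
  fixes q a b L M :: int
  assumes "prime q" "4 * q = a ^ 2 + 27 * b ^ 2" "4 * q = L ^ 2 + 27 * M ^ 2"
  shows "b = M \<or> b = - M"
proof -
  have main: "b ^ 2 = M ^ 2"
    if dvd: "q dvd b * L - a * M" and a: "4 * q = a ^ 2 + 27 * b ^ 2" for a
  proof -
    have "16 * q ^ 2 = (a * L + 27 * b * M) ^ 2 + 27 * (b * L - a * M) ^ 2"
    proof -
      have "16 * q ^ 2 = (4 * q) * (4 * q)" by (simp add: power2_eq_square)
      also have "\<dots> = (a ^ 2 + 27 * b ^ 2) * (L ^ 2 + 27 * M ^ 2)" by (simp only: a[symmetric] assms(3)[symmetric])
      finally show ?thesis by (simp add: power2_eq_square algebra_simps)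
    qed
    then have le: "27 * (b * L - a * M) ^ 2 \<le> 16 * q ^ 2" by simp
    have "b * L - a * M = 0"
    proof (rule ccontr)
      assume nz: "b * L - a * M \<noteq> 0"
      then have "\<bar>q\<bar> \<le> \<bar>b * L - a * M\<bar>" using dvd by (rule dvd_imp_le_int)
      then have "q ^ 2 \<le> (b * L - a * M) ^ 2" by (simp only: abs_le_square_iff)
      moreover have "q ^ 2 > 0" using assms(1) prime_gt_0_int by simp
      ultimately show False using le by linarith
    qed
    then have "b * L = a * M" by simp
    then have "b ^ 2 * L ^ 2 = a ^ 2 * M ^ 2" by (metis power_mult_distrib)
    moreover have "b ^ 2 * L ^ 2 - a ^ 2 * M ^ 2 = 4 * q * (b ^ 2 - M ^ 2)"
    proof -
      have eqs: "L ^ 2 = 4 * q - 27 * M ^ 2" "a ^ 2 = 4 * q - 27 * b ^ 2" using a assms(3) by simp_all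
      show ?thesis unfolding eqs by (simp add: algebra_simps)
    qed
    ultimately have "4 * q * (b ^ 2 - M ^ 2) = 0" by simp
    then show ?thesis using assms(1) by auto
  qed
  have "(b * L - a * M) * (b * L - (- a) * M) = 4 * q * (b ^ 2 - M ^ 2)"
  proof -
    have "(b * L - a * M) * (b * L - (- a) * M) = b ^ 2 * L ^ 2 - a ^ 2 * M ^ 2"
      by (simp add: power2_eq_square algebra_simps)
    also have "L ^ 2 = 4 * q - 27 * M ^ 2" using assms(3) by simp
    also have "a ^ 2 = 4 * q - 27 * b ^ 2" using assms(2) by simp
    finally show ?thesis by (simp add: algebra_simps)
  qed
  then have "q dvd (b * L - a * M) * (b * L - (- a) * M)" by simp
  then have "q dvd b * L - a * M \<or> q dvd b * L - (- a) * M"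
    using assms(1) prime_dvd_mult_iff by blast
  then have "b ^ 2 = M ^ 2" using main[of a] main[of "- a"] assms(2) by auto
  then show ?thesis by (simp add: power2_eq_iff)
qed

text \<open>Nonzero cubes are the \<open>g^(3 s)\<close>, and exponents of \<open>g\<close> are
  determined modulo \<open>3 k\<close>, hence modulo 3.\<close>

lemma (in cubic_periods) cubic_residue_iff:
  assumes "[p = g ^ m] (mod q)"
  shows "cubic_residue_of (int p) (int q) \<longleftrightarrow> 3 dvd m"
proof
  assume "cubic_residue_of (int p) (int q)"
  then obtain y where y: "[int p = y ^ 3] (mod int q)" by (auto simp: cubic_residue_of_def)
  define c where "c = nat (y mod int q)"
  have "[y = int c] (mod int q)" using q_gt_1 by (simp add: c_def cong_def)
  then have "[int p = int c ^ 3] (mod int q)" using y cong_pow cong_trans by blast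
  then have pc: "[p = c ^ 3] (mod q)" by (metis cong_int_iff of_nat_power)
  have "coprime q (g ^ m)" using coprime_g by simp
  then have "\<not> q dvd g ^ m" using q_gt_1 by (metis coprime_absorb_left nat_dvd_1_iff_1 less_irrefl)
  then have "\<not> q dvd c ^ 3" using cong_dvd_iff[OF cong_trans[OF cong_sym[OF pc] assms]] by simp
  then have "\<not> q dvd c" by (metis dvd_power dvd_trans zero_less_numeral)
  then obtain s where "[c = g ^ s] (mod q)" using ex_power_g by blast
  then have "[c ^ 3 = g ^ (3 * s)] (mod q)" using cong_pow[of c "g ^ s" q 3] by (simp add: power_mult mult.commute)
  then have "[g ^ m = g ^ (3 * s)] (mod q)" using pc assms cong_sym cong_trans by blast
  then have "[m = 3 * s] (mod (3 * k))" by (simp add: power_g_cong_iff_k)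
  then have "[m = 3 * s] (mod 3)" by (rule cong_dvd_modulus_nat) simp
  then show "3 dvd m" by (simp add: cong_dvd_iff)
next
  assume "3 dvd m"
  then obtain s where "m = 3 * s" by blast
  then have "[p = (g ^ s) ^ 3] (mod q)" using assms by (simp add: power_mult mult.commute)
  then have "[int p = int (g ^ s) ^ 3] (mod int q)" by (metis cong_int_iff of_nat_power)
  then show "cubic_residue_of (int p) (int q)" unfolding cubic_residue_of_def by blast
qed

text \<open>The discriminant \<open>(q L)\<^sup>2\<close> of the cubic is a square, so one root modulo \<open>p\<close> yields
  two further ones.\<close>

lemma num_solutions_eq_3_iff_ex:
  fixes p q L M :: int
  assumes "prime p" "p \<noteq> 2" "\<not> p dvd q" "\<not> p dvd L" and norm: "4 * q = L ^ 2 + 27 * M ^ 2"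
  shows "num_solutions_mod (\<lambda>x. x ^ 3 - q * x - q * M) p = 3 \<longleftrightarrow>
    (\<exists>x. p dvd x ^ 3 - q * x - q * M)"
proof
  assume "num_solutions_mod (\<lambda>x. x ^ 3 - q * x - q * M) p = 3"
  then have "{x \<in> {0..<p}. [x ^ 3 - q * x - q * M = 0] (mod p)} \<noteq> {}"
    unfolding num_solutions_mod_def by (metis card.empty zero_neq_numeral)
  then show "\<exists>x. p dvd x ^ 3 - q * x - q * M" by (auto simp: cong_0_iff)
next
  assume "\<exists>x. p dvd x ^ 3 - q * x - q * M"
  then obtain r where r: "p dvd r ^ 3 - q * r - q * M" by blast
  have p0: "p > 0" using assms(1) prime_gt_0_int by blast
  have pm: "p dvd x * y \<longleftrightarrow> p dvd x \<or> p dvd y" for x y using assms(1) by (rule prime_dvd_mult_iff)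
  have qL: "\<not> p dvd q * L" using assms pm by simp
  have "\<not> p dvd 2"
  proof
    assume "p dvd 2"
    then show False using assms(1,2) primes_dvd_imp_eq[of p 2] by simp
  qed
  then have "coprime 2 p" using assms(1) by (metis coprime_commute prime_imp_coprime)
  then obtain h where h: "[2 * h = 1] (mod p)" using cong_solve_coprime_int by blast
  \<comment> \<open>Dividing by \<open>x - r\<close> leaves \<open>x^2 + r x + r^2 - q\<close>, with
    discriminant \<open>4 q - 3 r^2\<close> and value \<open>3 r^2 - q\<close> at \<open>r\<close>.
    The discriminant of the cubic is the first times the square of the second.\<close>
  have disc: "p dvd (4 * q - 3 * r ^ 2) * (3 * r ^ 2 - q) ^ 2 - (q * L) ^ 2"
  proof -
    have "L ^ 2 = 4 * q - 27 * M ^ 2" using norm by simp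
    then have "(4 * q - 3 * r ^ 2) * (3 * r ^ 2 - q) ^ 2 - (q * L) ^ 2 =
        (4 * q - 3 * r ^ 2) * (3 * r ^ 2 - q) ^ 2 - q ^ 2 * (4 * q - 27 * M ^ 2)"
      by (simp add: power_mult_distrib)
    also have "\<dots> = (r ^ 3 - q * r - q * M) * (- 27 * (r ^ 3 - q * r + q * M))"
      by (simp add: power2_eq_square power3_eq_cube algebra_simps)
    finally show ?thesis using r by (metis dvd_mult2)
  qed
  have n: "\<not> p dvd 3 * r ^ 2 - q"
  proof
    assume "p dvd 3 * r ^ 2 - q"
    then have "p dvd (4 * q - 3 * r ^ 2) * (3 * r ^ 2 - q) ^ 2" by (simp add: power2_eq_square)
    then have "p dvd (q * L) ^ 2" using disc by (metis dvd_diff_right_iff)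
    then show False using qL pm by (simp add: power2_eq_square)
  qed
  then have "coprime (3 * r ^ 2 - q) p" using assms(1) by (metis coprime_commute prime_imp_coprime)
  then obtain c where c: "[(3 * r ^ 2 - q) * c = 1] (mod p)" using cong_solve_coprime_int by blast
  \<comment> \<open>\<open>t\<close> represents \<open>q L / (3 r^2 - q)\<close>, a square root of
    \<open>4 q - 3 r^2\<close> modulo \<open>p\<close>.\<close>
  define t where "t = c * (q * L)"
  have "[c ^ 2 * ((4 * q - 3 * r ^ 2) * (3 * r ^ 2 - q) ^ 2) = c ^ 2 * (q * L) ^ 2] (mod p)"
    using disc by (intro cong_mult cong_refl) (simp add: cong_iff_dvd_diff)
  then have "[((3 * r ^ 2 - q) * c) ^ 2 * (4 * q - 3 * r ^ 2) = t ^ 2] (mod p)"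
    by (simp add: t_def power_mult_distrib mult_ac)
  moreover have "[((3 * r ^ 2 - q) * c) ^ 2 * (4 * q - 3 * r ^ 2) = 1 ^ 2 * (4 * q - 3 * r ^ 2)] (mod p)"
    by (intro cong_mult cong_pow c cong_refl)
  ultimately have t: "[t ^ 2 = 4 * q - 3 * r ^ 2] (mod p)" using cong_sym cong_trans by fastforce
  have "\<not> p dvd t"
  proof
    assume "p dvd t"
    then have "p dvd (3 * r ^ 2 - q) * c * (q * L)" by (simp add: t_def mult.assoc)
    moreover have "[(3 * r ^ 2 - q) * c * (q * L) = 1 * (q * L)] (mod p)"
      by (intro cong_mult c cong_refl)
    ultimately show False using qL by (simp add: cong_dvd_iff)
  qed
  \<comment> \<open>The quadratic formula, with \<open>h\<close> as the inverse of 2.\<close>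
  define r1 where "r1 = h * (t - r)"
  define r2 where "r2 = h * (- t - r)"
  have quad: "[(x - r1) * (x - r2) = x ^ 2 + r * x + r ^ 2 - q] (mod p)" for x
  proof -
    have "(x - r1) * (x - r2) = x ^ 2 + (2 * h) * r * x + h ^ 2 * (r ^ 2 - t ^ 2)"
      by (simp add: r1_def r2_def power2_eq_square algebra_simps)
    also have "[\<dots> = x ^ 2 + 1 * r * x + h ^ 2 * (r ^ 2 - (4 * q - 3 * r ^ 2))] (mod p)"
      by (intro cong_add cong_mult cong_diff cong_refl h t)
    also have "x ^ 2 + 1 * r * x + h ^ 2 * (r ^ 2 - (4 * q - 3 * r ^ 2)) =
        x ^ 2 + r * x + (2 * h) ^ 2 * (r ^ 2 - q)"
      by (simp add: power2_eq_square algebra_simps)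
    also have "[\<dots> = x ^ 2 + r * x + 1 ^ 2 * (r ^ 2 - q)] (mod p)"
      by (intro cong_add cong_mult cong_pow cong_refl h)
    finally show ?thesis by (simp add: add_diff_eq)
  qed
  have factor: "p dvd x ^ 3 - q * x - q * M \<longleftrightarrow> p dvd x - r \<or> p dvd x - r1 \<or> p dvd x - r2" for x
  proof -
    have "[(x - r) * ((x - r1) * (x - r2)) + 0 =
        (x - r) * (x ^ 2 + r * x + r ^ 2 - q) + (r ^ 3 - q * r - q * M)] (mod p)"
      using r by (intro cong_add cong_mult cong_refl quad) (simp add: cong_sym_eq[of 0] cong_0_iff)
    also have "(x - r) * (x ^ 2 + r * x + r ^ 2 - q) + (r ^ 3 - q * r - q * M) = x ^ 3 - q * x - q * M"
      by (simp add: power2_eq_square power3_eq_cube algebra_simps)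
    finally have "p dvd (x - r) * ((x - r1) * (x - r2)) \<longleftrightarrow> p dvd x ^ 3 - q * x - q * M"
      by (simp add: cong_dvd_iff)
    then show ?thesis by (simp only: pm)
  qed
  have ne: "\<not> p dvd r - r1" "\<not> p dvd r - r2"
  proof -
    have "[(r - r1) * (r - r2) = 3 * r ^ 2 - q] (mod p)"
      using quad[of r] by (simp add: power2_eq_square)
    then show "\<not> p dvd r - r1" "\<not> p dvd r - r2" using n cong_dvd_iff pm by blast+
  qed
  have ne12: "\<not> p dvd r1 - r2"
  proof -
    have "[(2 * h) * t = 1 * t] (mod p)" by (intro cong_mult h cong_refl)
    moreover have "r1 - r2 = (2 * h) * t" by (simp add: r1_def r2_def algebra_simps)
    ultimately show ?thesis using \<open>\<not> p dvd t\<close> by (simp add: cong_dvd_iff)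
  qed
  have residue: "0 \<le> x \<and> x < p \<and> p dvd x - y \<longleftrightarrow> x = y mod p" for x y
    using p0 unfolding mod_eq_dvd_iff[symmetric] by auto
  have "{x \<in> {0..<p}. [x ^ 3 - q * x - q * M = 0] (mod p)} = {r mod p, r1 mod p, r2 mod p}"
    unfolding cong_0_iff factor using residue[of _ r] residue[of _ r1] residue[of _ r2] by auto
  moreover have "card {r mod p, r1 mod p, r2 mod p} = 3"
    using ne ne12 by (simp add: mod_eq_dvd_iff)
  ultimately show "num_solutions_mod (\<lambda>x. x ^ 3 - q * x - q * M) p = 3"
    unfolding num_solutions_mod_def by simp
qed

theorem theorem2p7:
  fixes p q L M :: int
  assumes "prime q" and "\<exists>k. q = 3 * k + 1"
    and "4 * q = L ^ 2 + 27 * M ^ 2" and "[L = 1] (mod 3)"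
    and "prime p" and "p \<noteq> 2" and "p \<noteq> 3" and "p \<noteq> q"
    and "\<not> p dvd L * (L ^ 2 - 9 * M ^ 2)"
  shows "num_solutions_mod (\<lambda>x. x ^ 3 - q * x - q * M) p = 3 \<longleftrightarrow> cubic_residue_of p q"
proof -
  define p' q' where "p' = nat p" and "q' = nat q"
  have p: "p = int p'" and q: "q = int q'"
    using assms(1,5) prime_gt_0_int by (auto simp: p'_def q'_def less_imp_le)
  have prime: "prime p'" "prime q'" using assms(1,5) p q by auto
  obtain k where k: "q = 3 * k + 1" using assms(2) by blast
  have "q' > 1" using prime(2) prime_gt_1_nat by blast
  then have q': "q' = 3 * nat k + 1" using k q by linarith
  obtain g where g: "g \<in> totatives q'" "ord q' g = q' - 1"
    using residue_prime_has_primroot[OF prime(2)] by blast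
  interpret cubic_periods q' g "nat k"
    using prime(2) g q' by unfold_locales (auto simp: totatives_def coprime_commute)
  have "\<not> q' dvd p'" using primes_dvd_imp_eq[OF prime(2,1)] assms(8) p q by auto
  then obtain m where m: "[p' = g ^ m] (mod q')" using ex_power_g by blast
  obtain a b where ab: "4 * int q' = a ^ 2 + 27 * b ^ 2"
    "ideal_cong 0 (all_one_poly q') (period_diff 0 * period_diff 1 * period_diff 2) (of_int (int q' * b))"
    using ex_norm_form_and_sym3 by blast
  have "b = M \<or> b = - M" using norm_form_unique[OF assms(1) _ assms(3)] ab(1) q by blast
  \<comment> \<open>Replacing \<open>x\<close> by \<open>-x\<close> exchanges the cubics for
    \<open>M\<close> and \<open>-M\<close>, so the sign of \<open>b\<close> is immaterial.\<close>
  then have bM: "(\<exists>x. p dvd x ^ 3 - q * x - q * b) \<longleftrightarrow> (\<exists>x. p dvd x ^ 3 - q * x - q * M)"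
  proof
    assume b: "b = - M"
    have "(- x) ^ 3 - q * (- x) - q * b = - (x ^ 3 - q * x - q * M)" for x
      unfolding b by (simp add: power3_eq_cube)
    then have "p dvd (- x) ^ 3 - q * (- x) - q * b \<longleftrightarrow> p dvd x ^ 3 - q * x - q * M" for x
      by (metis dvd_minus_iff)
    then show ?thesis by (metis minus_minus)
  qed simp
  have "\<not> p dvd L" using assms(9) by (meson dvd_mult2)
  moreover have "\<not> p dvd q" using assms(8) primes_dvd_imp_eq[OF assms(5,1)] by blast
  ultimately have "num_solutions_mod (\<lambda>x. x ^ 3 - q * x - q * M) p = 3 \<longleftrightarrow>
      (\<exists>x. p dvd x ^ 3 - q * x - q * M)"
    using assms(3,5,6) by (intro num_solutions_eq_3_iff_ex)
  also have "\<dots> \<longleftrightarrow> (\<exists>x. p dvd x ^ 3 - q * x - q * b)" using bM by blast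
  also have "\<dots> \<longleftrightarrow> 3 dvd m"
    using ex_root_if_cube[OF prime(1) m ab(2)] cube_if_root[OF prime(1) m ab(2)] assms(7,8)
    unfolding p q by auto
  also have "\<dots> \<longleftrightarrow> cubic_residue_of p q" unfolding p q using cubic_residue_iff[OF m] by simp
  finally show ?thesis .
qed

end
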